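(* Let $t_m$ be the Tribonacci numbers with $t_{-2}=0$, $t_{-1}=t_0=1$, $t_m=t_{m-1}+t_{m-2}+t_{m-3}$ for $m\ge 1$, and let $A(n)$ be the number of distinct squares occurring in the prefix $\mathbb{T}[1,n]$ of the Tribonacci sequence $\mathbb{T}$. For every $m\ge 3$, $$A(t_m)=\tfrac12\left(2t_{m-2}+t_{m-3}+3t_{m-4}-m-5\right).$$
   Context: The Tribonacci sequence $\mathbb{T}$ is the infinite word over $\{a,b,c\}$ that is the fixed point beginning with $a$ of the substitution $\sigma(a)=ab$, $\sigma(b)=ac$, $\sigma(c)=a$. Letters are indexed from $1$, and $\mathbb{T}[1,n]$ denotes the prefix of $\mathbb{T}$ of length $n$. The notation $u\prec v$ means that $u$ is a factor (contiguous subword) of $v$. The number of distinct squares is $A(n)=\sharp\{\omega : \omega \text{ a nonempty finite word},\ \omega\omega\prec\mathbb{T}[1,n]\}$. *)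

theory Defs
  imports Complex_Main "HOL-Library.Stream" "HOL-Library.Sublist"
begin

datatype letter = La | Lb | Lc

fun sigma :: "letter \<Rightarrow> letter list" where
  "sigma La = [La, Lb]"
| "sigma Lb = [La, Lc]"
| "sigma Lc = [La]"

text \<open>On an infinite word the substitution is \<open>x \<mapsto> flat (smap sigma x)\<close>, the concatenation of
  the images of its letters (none of which is empty).\<close>

definition is_tribonacci :: "letter stream \<Rightarrow> bool" where
  "is_tribonacci x \<longleftrightarrow> flat (smap sigma x) = x \<and> shd x = La"

definition tribonacci_word :: "letter stream" where
  "tribonacci_word = (THE x. is_tribonacci x)"

text \<open>\<open>stake n x\<close> is the prefix of length \<open>n\<close>; \<open>sublist\<close> is the contiguous factor relation.\<close>

definition num_squares :: "nat \<Rightarrow> nat" where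
  "num_squares n = card {w. w \<noteq> [] \<and> sublist (w @ w) (stake n tribonacci_word)}"

text \<open>Only indices \<open>m \<ge> -2\<close> are meaningful; below that the value is a dummy 0.\<close>

function trib :: "int \<Rightarrow> nat" where
  "trib m = (if m \<le> -2 then 0 else if m \<le> 0 then 1
             else trib (m - 1) + trib (m - 2) + trib (m - 3))"
  by pat_completeness auto
termination by (relation "measure (\<lambda>m. nat (m + 2))") auto

declare trib.simps [simp del]

lemma trib_initial: "trib (-2) = 0" "trib (-1) = 1" "trib 0 = 1"
  by (simp_all add: trib.simps)

lemma trib_rec: "m \<ge> 1 \<Longrightarrow> trib m = trib (m - 1) + trib (m - 2) + trib (m - 3)"
  by (subst trib.simps) simp

lemma finite_squares: "finite {w. w \<noteq> [] \<and> sublist (w @ w) (stake n tribonacci_word)}"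
proof (rule finite_subset)
  show "{w. w \<noteq> [] \<and> sublist (w @ w) (stake n tribonacci_word)}
      \<subseteq> {w. set w \<subseteq> {La, Lb, Lc} \<and> length w \<le> n}"
  proof clarsimp
    fix w assume "sublist (w @ w) (stake n tribonacci_word)"
    then have "length (w @ w) \<le> n" by (metis sublist_length_le length_stake)
    moreover have "set w \<subseteq> {La, Lb, Lc}" using letter.exhaust by blast
    ultimately show "set w \<subseteq> {La, Lb, Lc} \<and> length w \<le> n" by simp
  qed
  show "finite {w. set w \<subseteq> {La, Lb, Lc} \<and> length w \<le> n}"
    by (rule finite_lists_length_le) simp
qed

text \<open>The fixed point exists and is unique, so the description above is proper.\<close>

definition sigma_word :: "letter list \<Rightarrow> letter list" where
  "sigma_word w = concat (map sigma w)"

definition iter_word :: "nat \<Rightarrow> letter list" where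
  "iter_word n = (sigma_word ^^ n) [La]"

lemma sigma_neq_Nil [simp]: "sigma l \<noteq> []"
  by (cases l) auto

lemma flat_sigma_shift: "flat (smap sigma (w @- s)) = sigma_word w @- flat (smap sigma s)"
  by (induction w) (simp_all add: sigma_word_def)

lemma sigma_word_append: "sigma_word (u @ v) = sigma_word u @ sigma_word v"
  by (simp add: sigma_word_def)

lemma length_sigma_word: "length w \<le> length (sigma_word w)"
proof (induction w)
  case (Cons l w)
  then show ?case by (cases l) (simp_all add: sigma_word_def)
qed (simp add: sigma_word_def)

lemma iter_word_Suc: "iter_word (Suc n) = sigma_word (iter_word n)"
  by (simp add: iter_word_def)

lemma iter_word_decomp: "\<exists>v. v \<noteq> [] \<and> iter_word (Suc n) = iter_word n @ v"
proof (induction n)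
  case 0
  then show ?case by (simp add: iter_word_def sigma_word_def)
next
  case (Suc n)
  then obtain v where v: "v \<noteq> []" "iter_word (Suc n) = iter_word n @ v" by blast
  have "sigma_word v \<noteq> []" using length_sigma_word[of v] v(1) by auto
  then show ?case using v(2) by (metis iter_word_Suc sigma_word_append)
qed

lemma length_iter_word: "n < length (iter_word n)"
proof (induction n)
  case (Suc n)
  obtain v where "v \<noteq> []" "iter_word (Suc n) = iter_word n @ v"
    using iter_word_decomp by blast
  then show ?case using Suc by (cases v) auto
qed (simp add: iter_word_def)

lemma iter_word_prefix: "m \<le> n \<Longrightarrow> prefix (iter_word m) (iter_word n)"
proof (induction n rule: dec_induct)
  case (step k)
  then show ?case using iter_word_decomp[of k] by (metis prefixI prefix_order.trans)
qed simp

lemma tribonacci_iter_word: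
  assumes "is_tribonacci x"
  shows "\<exists>s. x = iter_word n @- s"
proof (induction n)
  case 0
  have "x = [La] @- stl x" using assms unfolding is_tribonacci_def by (cases x) simp
  then show ?case by (auto simp: iter_word_def)
next
  case (Suc n)
  then obtain s where "x = iter_word n @- s" by blast
  then have "flat (smap sigma x) = iter_word (Suc n) @- flat (smap sigma s)"
    by (simp only: flat_sigma_shift iter_word_Suc)
  then show ?case using assms unfolding is_tribonacci_def by metis
qed

lemma stream_eqI: "(\<And>i. x !! i = y !! i) \<Longrightarrow> x = y"
  by (metis ext smap_alt stream.map_id)

lemma ex1_tribonacci: "\<exists>!x. is_tribonacci x"
proof (rule ex_ex1I)
  define x where "x = smap (\<lambda>i. iter_word i ! i) nats"
  have nth: "x !! i = iter_word n ! i" if "i < length (iter_word n)" for i n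
  proof -
    have "iter_word i ! i = iter_word n ! i"
    proof (cases "i \<le> n")
      case True
      then obtain v where "iter_word n = iter_word i @ v"
        using iter_word_prefix prefixE by metis
      then show ?thesis using length_iter_word[of i] by (simp add: nth_append)
    next
      case False
      then obtain v where "iter_word i = iter_word n @ v"
        using iter_word_prefix[of n i] prefixE by (metis nat_le_linear)
      then show ?thesis using that by (simp add: nth_append)
    qed
    then show ?thesis by (simp add: x_def)
  qed
  have dec: "x = iter_word n @- sdrop (length (iter_word n)) x" for n
  proof -
    have "stake (length (iter_word n)) x = iter_word n"
      by (rule nth_equalityI) (simp_all add: nth)
    then show ?thesis by (metis stake_sdrop)
  qed
  have "flat (smap sigma x) = x"
  proof (rule stream_eqI)
    fix i
    have "i < length (iter_word (Suc i))" using length_iter_word[of "Suc i"] by simp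
    moreover have "flat (smap sigma x)
        = iter_word (Suc i) @- flat (smap sigma (sdrop (length (iter_word i)) x))"
      by (metis dec flat_sigma_shift iter_word_Suc)
    ultimately show "flat (smap sigma x) !! i = x !! i" by (simp add: nth)
  qed
  moreover have "shd x = La" by (simp add: x_def iter_word_def)
  ultimately show "\<exists>x. is_tribonacci x" unfolding is_tribonacci_def by blast
next
  fix x y assume xy: "is_tribonacci x" "is_tribonacci y"
  show "x = y"
  proof (rule stream_eqI)
    fix i
    obtain s t where "x = iter_word i @- s" "y = iter_word i @- t"
      using xy tribonacci_iter_word by meson
    then show "x !! i = y !! i" using length_iter_word[of i] by simp
  qed
qed

lemma is_tribonacci_tribonacci_word: "is_tribonacci tribonacci_word"
  unfolding tribonacci_word_def by (rule theI') (rule ex1_tribonacci)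

end

theory Submission
  imports Defs
begin

text \<open>
  The idea is to trace every square back to a single letter. Suppose that the letters of the
  Tribonacci word agree at distance \<open>p\<close> on a stretch of \<open>L\<close> positions that cannot be extended to
  the left. If \<open>L > 0\<close>, the stretch begins with \<open>a\<close>. The letter \<open>a\<close> occurs exactly where the image
  of a letter starts, and the position after such an \<open>a\<close> reveals which letter has that image. So
  the agreement can be pulled back through \<open>\<sigma>\<close> to a shorter stretch that again cannot be extended
  to the left. As long as \<open>p \<le> L + 1\<close>, a condition that survives the pull-back, the descent ends
  with an empty stretch and \<open>p = 1\<close>, that is, with one letter \<open>z\<close> at some position \<open>R\<close>. Undoing \<open>k\<close>
  steps of the descent gives \<open>letter_of_period\<close>: the period is \<open>\<bar>\<sigma>\<^sup>k(z)\<bar>\<close>, the stretch starts where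
  \<open>\<sigma>\<^sup>k\<close> of the letter at \<open>R\<close> starts, and \<open>L \<le> \<bar>v\<^sub>k\<bar>\<close>, where \<open>v\<^sub>0\<close> is empty and
  \<open>v\<^sub>k\<^sub>+\<^sub>1 = \<sigma>(v\<^sub>k)a\<close>. Conversely the images under \<open>\<sigma>\<^sup>k\<close> of any two neighbouring letters start at two
  positions that are both followed by \<open>v\<^sub>k\<close>, so all these agreements really occur. Hence the square
  roots are precisely the rotations of \<open>\<sigma>\<^sup>k(z)\<close> by \<open>s\<close> with \<open>s + \<bar>\<sigma>\<^sup>k(z)\<bar> \<le> \<bar>v\<^sub>k\<bar>\<close>, and the position
  of each occurrence is known (\<open>square_root_characterization\<close>).

  The letters \<open>a\<close>, \<open>b\<close>, \<open>c\<close> first occur at positions 0, 1 and 3. Comparing the lengths of the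
  images of the words before them with \<open>t\<^sub>m\<close>, where \<open>m = n + 3\<close>, shows which squares fit into the
  prefix of that length (\<open>squares_of_prefix\<close>): those from \<open>a\<close> and from \<open>b\<close> at levels \<open>k \<le> n + 1\<close>,
  and those from \<open>c\<close> at levels \<open>k \<le> n\<close>. Since \<open>\<sigma>\<^sup>k\<^sup>+\<^sup>1(c) = \<sigma>\<^sup>k(a)\<close> and \<open>v\<^sub>k\<^sub>+\<^sub>1\<close> is long enough, the
  letter \<open>c\<close> contributes all rotations of \<open>\<sigma>\<^sup>k(a)\<close> for \<open>k < n\<close>.

  Nothing is counted twice, because \<open>\<sigma>\<close> acts on letter counts by a unimodular matrix: a common
  divisor of the letter counts of \<open>\<sigma>\<^sup>k(z)\<close> divides those of \<open>z\<close>, which makes \<open>\<sigma>\<^sup>k(z)\<close> primitive, and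
  the counts determine \<open>k\<close> and \<open>z \<in> {a, b}\<close> (\<open>rotate_sig_inj\<close>). What remains is the sum of the
  numbers of offsets \<open>s\<close>, in which \<open>2\<bar>v\<^sub>k\<bar> + 3 = \<bar>\<sigma>\<^sup>k(a)\<bar> + \<bar>\<sigma>\<^sup>k(b)\<bar> + \<bar>\<sigma>\<^sup>k(c)\<bar>\<close>.
\<close>

section \<open>Positions under the substitution\<close>

abbreviation T :: "nat \<Rightarrow> letter" where
  "T i \<equiv> tribonacci_word !! i"

abbreviation fac :: "nat \<Rightarrow> nat \<Rightarrow> letter list" where
  "fac i j \<equiv> map T [i..<j]"

text \<open>Position \<open>pos n\<close> of the fixed point is where the image of its letter \<open>n\<close> begins, so
  \<open>(pos ^^ k) n\<close> is where the \<open>k\<close>-fold image of that letter begins.\<close>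

definition pos :: "nat \<Rightarrow> nat" where
  "pos n = length (sigma_word (fac 0 n))"

abbreviation sig :: "nat \<Rightarrow> letter \<Rightarrow> letter list" where
  "sig k z \<equiv> (sigma_word ^^ k) [z]"

lemma fac_append: "i \<le> j \<Longrightarrow> j \<le> k \<Longrightarrow> fac i j @ fac j k = fac i k"
  by (metis map_append upt_add_eq_append le_Suc_ex)

lemma stake_eq_fac: "stake n tribonacci_word = fac 0 n"
  by (rule nth_equalityI) auto

lemma sublist_prefix_iff:
  "sublist u (stake n tribonacci_word) \<longleftrightarrow> (\<exists>x. x + length u \<le> n \<and> fac x (x + length u) = u)"
proof
  assume "sublist u (stake n tribonacci_word)"
  then obtain ps ss where e: "fac 0 n = ps @ u @ ss"
    unfolding sublist_def stake_eq_fac by blast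
  let ?x = "length ps"
  have le: "?x + length u \<le> n"
    using arg_cong[OF e, of length] by simp
  have "fac ?x (?x + length u) = u"
  proof (rule nth_equalityI)
    fix j assume "j < length (fac ?x (?x + length u))"
    then have j: "j < length u" by simp
    then have "fac 0 n ! (?x + j) = u ! j" by (simp add: e nth_append)
    then show "fac ?x (?x + length u) ! j = u ! j" using j le by simp
  qed simp
  with le show "\<exists>x. x + length u \<le> n \<and> fac x (x + length u) = u" by blast
next
  assume "\<exists>x. x + length u \<le> n \<and> fac x (x + length u) = u"
  then obtain x where x: "x + length u \<le> n" "fac x (x + length u) = u" by blast
  have "fac 0 n = fac 0 x @ u @ fac (x + length u) n"
    using fac_append[of 0 x n] fac_append[of x "x + length u" n] x by simp
  then show "sublist u (stake n tribonacci_word)"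
    unfolding sublist_def stake_eq_fac by blast
qed

lemma fac_0_pos: "fac 0 (pos n) = sigma_word (fac 0 n)"
proof -
  have "flat (smap sigma tribonacci_word) = tribonacci_word"
    using is_tribonacci_tribonacci_word by (simp add: is_tribonacci_def)
  then have "tribonacci_word
      = sigma_word (fac 0 n) @- flat (smap sigma (sdrop n tribonacci_word))"
    by (metis flat_sigma_shift stake_eq_fac stake_sdrop)
  then have "stake (pos n) tribonacci_word = sigma_word (fac 0 n)"
    by (metis pos_def stake_shift order_refl diff_self_eq_0 stake.simps(1) append_Nil2 take_all)
  then show ?thesis by (simp add: stake_eq_fac)
qed

lemma pos_0 [simp]: "pos 0 = 0"
  by (simp add: pos_def sigma_word_def)

lemma pos_Suc: "pos (Suc n) = pos n + length (sigma (T n))"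
  by (simp add: pos_def sigma_word_def)

lemma strict_mono_pos: "strict_mono pos"
  by (rule strict_mono_Suc_iff[THEN iffD2]) (simp add: pos_Suc)

lemma fac_pos: "m \<le> n \<Longrightarrow> fac (pos m) (pos n) = sigma_word (fac m n)"
proof -
  assume mn: "m \<le> n"
  then have "pos m \<le> pos n" using strict_mono_pos by (simp add: strict_mono_less_eq)
  then have "fac 0 (pos m) @ fac (pos m) (pos n) = sigma_word (fac 0 m @ fac m n)"
    using mn by (metis fac_append fac_0_pos zero_le)
  then show ?thesis by (simp only: sigma_word_append fac_0_pos same_append_eq)
qed

lemma strict_mono_pos_pow: "strict_mono (pos ^^ k)"
  by (induction k) (use strict_mono_pos in \<open>auto simp: strict_mono_def\<close>)

lemma pos_pow_0 [simp]: "(pos ^^ k) 0 = 0"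
  by (induction k) auto

lemma fac_pos_pow: "m \<le> n \<Longrightarrow> fac ((pos ^^ k) m) ((pos ^^ k) n) = (sigma_word ^^ k) (fac m n)"
proof (induction k)
  case (Suc k)
  then have "(pos ^^ k) m \<le> (pos ^^ k) n"
    using strict_mono_pos_pow by (simp add: strict_mono_less_eq)
  then show ?case using Suc by (simp add: fac_pos)
qed simp

lemma fac_pos_pow_Suc: "fac ((pos ^^ k) R) ((pos ^^ k) (Suc R)) = sig k (T R)"
  by (simp add: fac_pos_pow)

lemma pos_pow_Suc: "(pos ^^ k) (Suc R) = (pos ^^ k) R + length (sig k (T R))"
proof -
  have "(pos ^^ k) R \<le> (pos ^^ k) (Suc R)"
    using strict_mono_pos_pow by (simp add: strict_mono_less_eq)
  then show ?thesis using arg_cong[OF fac_pos_pow_Suc, of length k R] by simp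
qed

lemma T_block:
  assumes "j < length (sigma (T n))"
  shows "T (pos n + j) = sigma (T n) ! j"
proof -
  have "fac (pos n) (pos (Suc n)) = sigma (T n)"
    by (simp only: fac_pos[of n "Suc n"]) (simp add: sigma_word_def)
  then have "fac (pos n) (pos (Suc n)) ! j = sigma (T n) ! j" by simp
  then show ?thesis using assms by (simp add: pos_Suc)
qed

lemma T_pos [simp]: "T (pos n) = La"
  using T_block[of 0 n] by (cases "T n") auto

text \<open>The letter after the initial \<open>a\<close> of a block tells the blocks \<open>ab\<close>, \<open>ac\<close>, \<open>a\<close> apart; for the
  block \<open>a\<close> it is the initial \<open>a\<close> of the next block. This is what makes the pull-back of a
  periodicity possible.\<close>

lemma T_pos_plus_1:
  "T (pos n + 1) = (case T n of La \<Rightarrow> Lb | Lb \<Rightarrow> Lc | Lc \<Rightarrow> La)"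
proof (cases "T n")
  case Lc
  then show ?thesis using T_pos[of "Suc n"] by (simp add: pos_Suc)
qed (use T_block[of 1 n] in auto)

lemma block_of_index: "\<exists>n. pos n \<le> i \<and> i < pos (Suc n)"
proof (induction i)
  case 0
  then show ?case using strict_mono_pos by (metis pos_0 lessI strict_monoD le_refl)
next
  case (Suc i)
  then obtain n where n: "pos n \<le> i" "i < pos (Suc n)" by blast
  show ?case
  proof (cases "Suc i < pos (Suc n)")
    case True
    then show ?thesis using n by (intro exI[of _ n]) simp
  next
    case False
    moreover have "pos (Suc n) < pos (Suc (Suc n))"
      using strict_mono_pos by (simp add: strict_monoD)
    ultimately show ?thesis using n by (intro exI[of _ "Suc n"]) simp
  qed
qed

lemma T_La_imp_pos: "T i = La \<Longrightarrow> \<exists>n. i = pos n"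
proof -
  assume a: "T i = La"
  obtain n where n: "pos n \<le> i" "i < pos (Suc n)" using block_of_index by blast
  have "i = pos n"
  proof (rule ccontr)
    assume "i \<noteq> pos n"
    then have "i = pos n + 1" "T n \<noteq> Lc"
      using n by (cases "T n"; simp add: pos_Suc)+
    then show False using a T_pos_plus_1[of n] by (cases "T n") auto
  qed
  then show ?thesis by blast
qed

lemma T_not_La:
  assumes "T i \<noteq> La"
  shows "i > 0" "T (i - 1) = La" "T (Suc i) = La"
proof -
  obtain n where n: "pos n \<le> i" "i < pos (Suc n)" using block_of_index by blast
  have "i \<noteq> pos n" using assms T_pos by metis
  then have i: "i = Suc (pos n)" "pos (Suc n) = Suc i"
    using n by (cases "T n"; simp add: pos_Suc)+
  then show "i > 0" "T (i - 1) = La" "T (Suc i) = La"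
    using T_pos[of n] T_pos[of "Suc n"] by simp_all
qed

text \<open>The three blocks also differ in their last letters, so a disagreement of two letters gives a
  disagreement just before the ends of their images.\<close>

lemma T_before_pos:
  "T (pos (Suc n) - 1) = (case T n of La \<Rightarrow> Lb | Lb \<Rightarrow> Lc | Lc \<Rightarrow> La)"
  using T_block[of "length (sigma (T n)) - 1" n] by (cases "T n") (auto simp: pos_Suc)

text \<open>The only block of length 1 is the image of \<open>c\<close>, and \<open>cc\<close> does not occur.\<close>

lemma pos_plus_2: "pos n + 3 \<le> pos (n + 2)"
proof (cases "T n = La")
  case False
  then have "T (Suc n) = La" by (rule T_not_La)
  then show ?thesis using False by (cases "T n") (auto simp: pos_Suc)
qed (cases "T (Suc n)"; simp add: pos_Suc)

section \<open>Periodicities come from single letters\<close>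

text \<open>These are the words \<open>\<epsilon>\<close>, \<open>a\<close>, \<open>aba\<close>, \<open>abacaba\<close>, \<dots>: the \<open>k\<close>-th one is the longest
  word that occurs at the start of the \<open>k\<close>-fold image of every letter of the fixed point.\<close>

fun bispecial :: "nat \<Rightarrow> letter list" where
  "bispecial 0 = []"
| "bispecial (Suc k) = sigma_word (bispecial k) @ [La]"

text \<open>If \<open>v\<close> occurs at \<open>i\<close>, then \<open>\<sigma>(v)\<close> occurs at \<open>pos i\<close>, and the block after \<open>\<sigma>(v)\<close>
  begins with \<open>a\<close> in any case.\<close>

lemma fac_bispecial: "fac ((pos ^^ k) R) ((pos ^^ k) R + length (bispecial k)) = bispecial k"
proof (induction k)
  case (Suc k)
  let ?i = "(pos ^^ k) R" and ?l = "length (bispecial k)"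
  have s: "fac (pos ?i) (pos (?i + ?l)) = sigma_word (bispecial k)"
    using fac_pos[of ?i "?i + ?l"] Suc by simp
  have "pos ?i \<le> pos (?i + ?l)" using strict_mono_pos by (simp add: strict_mono_less_eq)
  then have e: "pos (?i + ?l) = pos ?i + length (sigma_word (bispecial k))"
    using arg_cong[OF s, of length] by simp
  have "T (pos ?i + length (sigma_word (bispecial k))) = La"
    using T_pos[of "?i + ?l"] e by simp
  then show ?case using s e by simp
qed simp

lemma pos_bispecial:
  "pos ((pos ^^ k) R + length (bispecial k)) + 1 = pos ((pos ^^ k) R) + length (bispecial (Suc k))"
proof -
  let ?i = "(pos ^^ k) R" and ?l = "length (bispecial k)"
  have s: "fac (pos ?i) (pos (?i + ?l)) = sigma_word (bispecial k)"
    using fac_pos[of ?i "?i + ?l"] fac_bispecial[of k R] by simp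
  have "pos ?i \<le> pos (?i + ?l)" using strict_mono_pos by (simp add: strict_mono_less_eq)
  then show ?thesis using arg_cong[OF s, of length] by simp
qed

lemma period_of_letter:
  assumes "j < length (bispecial k)"
  shows "T ((pos ^^ k) R + j) = T ((pos ^^ k) (Suc R) + j)"
proof -
  have "fac ((pos ^^ k) R) ((pos ^^ k) R + length (bispecial k)) ! j
      = fac ((pos ^^ k) (Suc R)) ((pos ^^ k) (Suc R) + length (bispecial k)) ! j"
    by (simp only: fac_bispecial)
  then show ?thesis using assms by simp
qed

text \<open>The descent. A left-maximal nonempty agreement at distance \<open>p\<close> starts at block boundaries
  \<open>pos R\<close> and \<open>pos Q\<close>, and pulls back to an agreement at distance \<open>Q - R\<close>, which is left-maximal
  because different letters have blocks with different last letters. The condition \<open>p \<le> L + 1\<close>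
  rather than \<open>p \<le> L\<close> is the one preserved: under \<open>\<sigma>\<close> the agreement gains the initial \<open>a\<close> of the
  next block, so a gap between the two copies that consists of the letter \<open>c\<close> vanishes, whereas
  the image of two neighbouring letters has at least three letters, of which two remain. No
  maximality to the right is assumed, hence only an upper bound for \<open>L\<close> in the conclusion.\<close>

lemma letter_of_period:
  assumes "\<And>j. j < L \<Longrightarrow> T (i + j) = T (i + p + j)"
    and "i = 0 \<or> T (i - 1) \<noteq> T (i + p - 1)"
    and "0 < p" and "p \<le> L + 1"
  shows "\<exists>k R. i = (pos ^^ k) R \<and> i + p = (pos ^^ k) (Suc R) \<and> L \<le> length (bispecial k)"
  using assms
proof (induction L arbitrary: i p rule: less_induct)
  case (less L)
  note match = less.prems(1) and left = less.prems(2)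
  show ?case
  proof (cases "L = 0")
    case True
    then show ?thesis using less.prems by (intro exI[of _ 0] exI[of _ i]) simp
  next
    case False
    have "T i = La"
    proof (rule ccontr)
      assume n: "T i \<noteq> La"
      moreover have "T (i + p) \<noteq> La" using match[of 0] False n by simp
      ultimately have "i > 0" "T (i - 1) = La" "T (i + p - 1) = La"
        using T_not_La by blast+
      then show False using left by simp
    qed
    moreover from this have "T (i + p) = La" using match[of 0] False by simp
    ultimately obtain R Q where R: "i = pos R" and Q: "i + p = pos Q"
      using T_La_imp_pos by metis
    have mono: "pos x + (y - x) \<le> pos y" if "x \<le> y" for x y
      using that
    proof (induction y rule: dec_induct)
      case (step y)
      have "pos y < pos (Suc y)" using strict_mono_pos by (simp add: strict_monoD)
      then show ?case using step by simp
    qed simp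
    have RQ: "R < Q"
      using R Q \<open>0 < p\<close> strict_mono_less[OF strict_mono_pos, of R Q] by simp
    \<comment> \<open>The first \<open>l\<close> letters from \<open>R\<close> on are those for which the start of the block and the position
      after it, which identifies the block, lie inside the agreement.\<close>
    define l where "l = (LEAST l. L + pos R \<le> pos (R + l) + 1)"
    have "L + pos R \<le> pos (R + L) + 1" using mono[of R "R + L"] by simp
    then have l_enough: "L + pos R \<le> pos (R + l) + 1"
      unfolding l_def by (rule LeastI)
    have l_least: "pos (R + j) + 1 < L + pos R" if "j < l" for j
      using not_less_Least[of j] that unfolding l_def by force
    have letter: "T (R + j) = T (Q + j)"
      if "j < l" and p: "pos (Q + j) = pos (R + j) + p" for j
    proof -
      have "pos R \<le> pos (R + j)" using mono[of R "R + j"] by simp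
      then have "T (pos (R + j) + 1) = T (pos (Q + j) + 1)"
        using match[of "pos (R + j) + 1 - pos R"] l_least[OF \<open>j < l\<close>] p R
        by (simp add: add.commute add.left_commute)
      then show ?thesis
        unfolding T_pos_plus_1 by (cases "T (R + j)"; cases "T (Q + j)") auto
    qed
    have shift: "j \<le> l \<Longrightarrow> pos (Q + j) = pos (R + j) + p" for j
    proof (induction j)
      case 0
      then show ?case using R Q by simp
    next
      case (Suc j)
      then show ?case using letter[of j] by (simp add: pos_Suc)
    qed
    have "\<exists>k R'. R = (pos ^^ k) R' \<and> R + (Q - R) = (pos ^^ k) (Suc R') \<and> l \<le> length (bispecial k)"
    proof (rule less.IH)
      show "l < L"
      proof (cases l)
        case (Suc l')
        then show ?thesis using l_least[of l'] mono[of R "R + l'"] by simp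
      qed (use False in simp)
      show "T (R + j) = T (R + (Q - R) + j)" if "j < l" for j
        using letter[OF that] shift[of j] that RQ by simp
      \<comment> \<open>If the preceding letters agreed, so would the last letters of their blocks.\<close>
      show "R = 0 \<or> T (R - 1) \<noteq> T (R + (Q - R) - 1)"
      proof (rule ccontr)
        assume "\<not> ?thesis"
        then have "R > 0" "T (R - 1) = T (Q - 1)" using RQ by auto
        then have "T (pos R - 1) = T (pos Q - 1)"
          using T_before_pos[of "R - 1"] T_before_pos[of "Q - 1"] RQ by simp
        moreover have "i > 0" using mono[of 0 R] \<open>R > 0\<close> R by simp
        ultimately show False using left R Q by simp
      qed
      show "0 < Q - R" using RQ by simp
      show "Q - R \<le> l + 1"
      proof (rule ccontr)
        assume "\<not> ?thesis"
        then have "pos (R + l + 2) \<le> pos Q"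
          using strict_mono_less_eq[OF strict_mono_pos] by simp
        then show False
          using pos_plus_2[of "R + l"] l_enough \<open>p \<le> L + 1\<close> R Q by simp
      qed
    qed
    then obtain k R' where k: "R = (pos ^^ k) R'" "Q = (pos ^^ k) (Suc R')"
      "l \<le> length (bispecial k)" using RQ by auto
    have "pos (R + l) \<le> pos (R + length (bispecial k))"
      using k strict_mono_less_eq[OF strict_mono_pos] by simp
    then have "L \<le> length (bispecial (Suc k))"
      using l_enough pos_bispecial[of k R'] k by simp
    then show ?thesis using R Q k by (intro exI[of _ "Suc k"] exI[of _ R']) simp
  qed
qed

lemma fac_rotate:
  assumes "\<And>j. j < s \<Longrightarrow> T (i + j) = T (i + p + j)"
  shows "fac (i + s) (i + s + p) = rotate s (fac i (i + p))"
  using assms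
proof (induction s)
  case (Suc s)
  have eq: "T (i + s) = T (i + s + p)"
    using Suc.prems[of s] by (simp add: add.commute add.left_commute)
  have "rotate (Suc s) (fac i (i + p)) = rotate1 (fac (i + s) (i + s + p))"
    using Suc by simp
  also have "\<dots> = fac (i + Suc s) (i + Suc s + p)"
  proof (cases p)
    case (Suc p')
    then have "fac (i + s) (i + s + p) = T (i + s) # fac (i + Suc s) (i + s + p)"
      by (subst upt_conv_Cons) (simp_all del: upt_Suc)
    moreover have "fac (i + Suc s) (i + Suc s + p) = fac (i + Suc s) (i + s + p) @ [T (i + s + p)]"
      using Suc by simp
    ultimately show ?thesis using eq by simp
  qed simp
  finally show ?case by simp
qed simp


lemma square_root_iff:
  "w \<noteq> [] \<and> sublist (w @ w) (stake n tribonacci_word) \<longleftrightarrow>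
    (\<exists>x p. 0 < p \<and> x + 2 * p \<le> n \<and> (\<forall>j<p. T (x + j) = T (x + p + j)) \<and> w = fac x (x + p))"
    (is "?L \<longleftrightarrow> ?R")
proof
  assume L: ?L
  define p where "p = length w"
  obtain x where x: "x + 2 * p \<le> n" "fac x (x + 2 * p) = w @ w"
    using L unfolding sublist_prefix_iff p_def by (auto simp: mult_2 add.assoc)
  have "fac x (x + p) @ fac (x + p) (x + 2 * p) = w @ w"
    using fac_append[of x "x + p" "x + 2 * p"] x by simp
  then have w: "fac x (x + p) = w" "fac (x + p) (x + p + p) = w"
    by (simp_all add: p_def mult_2 add.assoc)
  have "\<forall>j<p. T (x + j) = T (x + p + j)"
  proof (intro allI impI)
    fix j assume that: "j < p"
    have "fac x (x + p) ! j = fac (x + p) (x + p + p) ! j" using w by simp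
    then show "T (x + j) = T (x + p + j)" using that by simp
  qed
  moreover have "0 < p" using L by (simp add: p_def)
  ultimately show ?R using x(1) w(1) by metis
next
  assume ?R
  then obtain x p where x: "0 < p" "x + 2 * p \<le> n" "\<forall>j<p. T (x + j) = T (x + p + j)"
    "w = fac x (x + p)" by blast
  have "fac (x + p) (x + p + p) = w"
    unfolding x(4) by (rule nth_equalityI) (use x(3) in auto)
  then have "fac x (x + 2 * p) = w @ w"
    using fac_append[of x "x + p" "x + 2 * p"] x(4) by (simp add: mult_2 add.assoc)
  then show ?L using x unfolding sublist_prefix_iff
    by (auto intro!: exI[of _ x] simp: mult_2 add.assoc)
qed

text \<open>For a square \<open>ww\<close> at \<open>x\<close>, let \<open>i \<le> x\<close> be the start of the left-maximal agreement at distance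
  \<open>\<bar>w\<bar>\<close> that covers it. By \<open>letter_of_period\<close>, \<open>\<sigma>\<^sup>k\<close> of a single letter starts at \<open>i\<close> and has length
  \<open>\<bar>w\<bar>\<close>; moving from \<open>i\<close> to \<open>x\<close> inside the agreement rotates it.\<close>

lemma square_root_characterization:
  "w \<noteq> [] \<and> sublist (w @ w) (stake n tribonacci_word) \<longleftrightarrow>
    (\<exists>k R s. s + length (sig k (T R)) \<le> length (bispecial k)
      \<and> (pos ^^ k) R + s + 2 * length (sig k (T R)) \<le> n
      \<and> w = rotate s (sig k (T R)))" (is "?L \<longleftrightarrow> ?R")
proof
  assume ?L
  then obtain x p where x: "0 < p" "x + 2 * p \<le> n" "\<And>j. j < p \<Longrightarrow> T (x + j) = T (x + p + j)"
    "w = fac x (x + p)" unfolding square_root_iff by blast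
  define i where "i = (LEAST i. \<forall>y. i \<le> y \<and> y < x \<longrightarrow> T y = T (y + p))"
  have ex: "\<forall>y. x \<le> y \<and> y < x \<longrightarrow> T y = T (y + p)" by auto
  have i: "\<forall>y. i \<le> y \<and> y < x \<longrightarrow> T y = T (y + p)"
    unfolding i_def
    by (rule LeastI[where P = "\<lambda>i. \<forall>y. i \<le> y \<and> y < x \<longrightarrow> T y = T (y + p)", OF ex])
  have ix: "i \<le> x" unfolding i_def by (rule Least_le) (use ex in blast)
  have left: "i = 0 \<or> T (i - 1) \<noteq> T (i + p - 1)"
  proof (rule ccontr)
    assume "\<not> ?thesis"
    then have i0: "i > 0" and e: "T (i - 1) = T (i - 1 + p)" by auto
    have "\<forall>y. i - 1 \<le> y \<and> y < x \<longrightarrow> T y = T (y + p)"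
    proof (intro allI impI)
      fix y assume y: "i - 1 \<le> y \<and> y < x"
      show "T y = T (y + p)"
      proof (cases "y = i - 1")
        case False
        then show ?thesis using i y by auto
      qed (use e in simp)
    qed
    then have "i \<le> i - 1"
      unfolding i_def by (rule Least_le)
    then show False using i0 by simp
  qed
  have match: "T (i + j) = T (i + p + j)" if "j < x + p - i" for j
  proof (cases "i + j < x")
    case True
    then show ?thesis using i by (simp add: add.commute add.left_commute)
  next
    case False
    then show ?thesis using x(3)[of "i + j - x"] that
      by (simp add: add.commute add.left_commute)
  qed
  have "p \<le> x + p - i + 1" using ix by simp
  then obtain k R where k: "i = (pos ^^ k) R" "i + p = (pos ^^ k) (Suc R)"
    "x + p - i \<le> length (bispecial k)"
    using letter_of_period[OF match left x(1)] by blast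
  have p: "p = length (sig k (T R))" using k pos_pow_Suc by simp
  have f: "fac i (i + p) = sig k (T R)" using k fac_pos_pow_Suc by simp
  have "w = rotate (x - i) (fac i (i + p))"
    using fac_rotate[of "x - i" i p] match ix x(1,4) by simp
  then show ?R
    using k p f x ix by (intro exI[of _ k] exI[of _ R] exI[of _ "x - i"]) simp
next
  assume ?R
  then obtain k R s where *: "s + length (sig k (T R)) \<le> length (bispecial k)"
      "(pos ^^ k) R + s + 2 * length (sig k (T R)) \<le> n"
      "w = rotate s (sig k (T R))" by blast
  define i p where "i = (pos ^^ k) R" and "p = length (sig k (T R))"
  have match: "T (i + j) = T (i + p + j)" if "j < length (bispecial k)" for j
    using period_of_letter[OF that, of R] pos_pow_Suc unfolding i_def p_def by simp
  have "0 < p" using strict_mono_pos_pow[of k] pos_pow_Suc[of k R]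
    unfolding p_def by (metis less_add_same_cancel1 lessI strict_monoD)
  moreover have "i + s + 2 * p \<le> n" using * by (simp add: i_def p_def)
  moreover have "T (i + s + j) = T (i + s + p + j)" if "j < p" for j
    using match[of "s + j"] that * by (simp add: p_def ac_simps)
  moreover have "w = fac (i + s) (i + s + p)"
  proof -
    have "fac i (i + p) = sig k (T R)"
      unfolding i_def p_def using fac_pos_pow_Suc pos_pow_Suc by simp
    moreover have "T (i + j) = T (i + p + j)" if "j < s" for j
      using match[of j] that * by simp
    ultimately show ?thesis using fac_rotate[of s i p] * by simp
  qed
  ultimately show ?L unfolding square_root_iff by blast
qed

section \<open>Primitivity and distinctness of the roots\<close>

lemma length_eq_counts: "length w = count_list w La + count_list w Lb + count_list w Lc"
proof (induction w)
  case (Cons z w)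
  then show ?case by (cases z) auto
qed simp

lemma count_sigma_word:
  "count_list (sigma_word w) La = length w"
  "count_list (sigma_word w) Lb = count_list w La"
  "count_list (sigma_word w) Lc = count_list w Lb"
proof -
  have "count_list (sigma_word w) La = length w \<and>
    count_list (sigma_word w) Lb = count_list w La \<and>
    count_list (sigma_word w) Lc = count_list w Lb"
  proof (induction w)
    case (Cons z w)
    then show ?case by (cases z) (auto simp: sigma_word_def)
  qed (simp add: sigma_word_def)
  then show "count_list (sigma_word w) La = length w"
  "count_list (sigma_word w) Lb = count_list w La"
  "count_list (sigma_word w) Lc = count_list w Lb" by auto
qed

lemma count_list_rotate: "count_list (rotate s w) = count_list w"
proof
  fix l show "count_list (rotate s w) l = count_list w l"
  proof (induction s)
    case (Suc s)
    have "count_list (rotate1 u) l = count_list u l" for u by (cases u) auto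
    then show ?case using Suc by simp
  qed simp
qed

text \<open>The incidence matrix of \<open>\<sigma>\<close> is invertible over the integers, so letter counts can be pulled
  back, and so can their common divisors.\<close>

lemma count_sigma_word_inj:
  assumes "count_list (sigma_word u) = count_list (sigma_word w)"
  shows "count_list u = count_list w"
proof
  fix l
  show "count_list u l = count_list w l"
    using fun_cong[OF assms, of La] fun_cong[OF assms, of Lb] fun_cong[OF assms, of Lc]
    by (cases l) (simp_all add: count_sigma_word length_eq_counts)
qed

lemma count_sigma_word_pow_inj:
  "count_list ((sigma_word ^^ k) u) = count_list ((sigma_word ^^ k) w) \<Longrightarrow> count_list u = count_list w"
  by (induction k) (auto dest: count_sigma_word_inj)

lemma dvd_counts_sigma_word:
  assumes "\<forall>l. d dvd count_list (sigma_word w) l"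
  shows "\<forall>l. d dvd count_list w l"
proof
  have a: "d dvd count_list w La" "d dvd count_list w Lb"
    using assms count_sigma_word by metis+
  have "d dvd count_list w La + count_list w Lb + count_list w Lc"
    using assms count_sigma_word(1) length_eq_counts by metis
  then have "d dvd count_list w Lc" using a by (simp add: dvd_add_right_iff)
  then show "d dvd count_list w l" for l using a by (cases l) auto
qed

lemma dvd_counts_sig:
  assumes "\<forall>l. d dvd count_list (sig k z) l"
  shows "d = (1::nat)"
proof -
  have "\<forall>l. d dvd count_list ((sigma_word ^^ k) w) l \<Longrightarrow> \<forall>l. d dvd count_list w l" for w
    by (induction k) (auto dest: dvd_counts_sigma_word)
  then have "d dvd count_list [z] z" using assms by blast
  then show ?thesis by simp
qed

lemma count_list_concat_replicate:
  "count_list (concat (replicate m w)) l = m * count_list w l"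
  by (induction m) auto

text \<open>Two equal rotations would make \<open>\<sigma>\<^sup>k(z)\<close> a rotation of a proper power, whose exponent divides
  all letter counts and hence those of the single letter \<open>z\<close>.\<close>

lemma rotate_sig_neq:
  assumes "s < s'" and "s' < length (sig k z)"
  shows "rotate s (sig k z) \<noteq> rotate s' (sig k z)"
proof
  assume e: "rotate s (sig k z) = rotate s' (sig k z)"
  define X where "X = rotate s (sig k z)"
  define r where "r = s' - s"
  have "rotate r X = X"
    unfolding X_def r_def rotate_rotate using e assms by simp
  moreover have r: "0 < r" "r < length X" using assms by (auto simp: r_def X_def)
  ultimately have "drop r X @ take r X = take r X @ drop r X"
    by (simp add: rotate_drop_take)
  then obtain m n zs where mn: "concat (replicate m zs) = drop r X"
      "concat (replicate n zs) = take r X"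
    using comm_append_are_replicate by metis
  have "m \<noteq> 0" "n \<noteq> 0" using mn r by (auto intro!: Nat.gr0I)
  have X: "X = concat (replicate (n + m) zs)"
    by (metis mn append_take_drop_id replicate_add concat_append)
  have "\<forall>l. n + m dvd count_list (sig k z) l"
    by (metis X X_def count_list_rotate count_list_concat_replicate dvd_triv_left)
  then have "n + m = 1" by (rule dvd_counts_sig)
  then show False using \<open>m \<noteq> 0\<close> \<open>n \<noteq> 0\<close> by simp
qed

lemma sigma_word_pow_append:
  "(sigma_word ^^ k) (u @ v) = (sigma_word ^^ k) u @ (sigma_word ^^ k) v"
  by (induction k) (auto simp: sigma_word_append)

lemma sig_Suc:
  "sig (Suc k) La = sig k La @ sig k Lb"
  "sig (Suc k) Lb = sig k La @ sig k Lc"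
  "sig (Suc k) Lc = sig k La"
proof -
  have "sigma_word [La] = [La] @ [Lb]" "sigma_word [Lb] = [La] @ [Lc]" "sigma_word [Lc] = [La]"
    by (simp_all add: sigma_word_def)
  then show "sig (Suc k) La = sig k La @ sig k Lb"
    "sig (Suc k) Lb = sig k La @ sig k Lc" "sig (Suc k) Lc = sig k La"
    by (simp_all only: funpow_Suc_right o_apply sigma_word_pow_append)
qed

lemma sig_pos: "0 < length (sig k z)"
proof (induction k)
  case (Suc k)
  then show ?case
    using length_sigma_word[of "sig k z"] by (simp del: length_greater_0_conv)
qed simp

lemma length_sig_ge_2:
  assumes "z \<noteq> Lc"
  shows "2 \<le> length (sig (Suc k) z)"
proof (cases z)
  case La
  show ?thesis
    unfolding La sig_Suc length_append using sig_pos[of k La] sig_pos[of k Lb] by linarith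
next
  case Lb
  show ?thesis
    unfolding Lb sig_Suc length_append using sig_pos[of k La] sig_pos[of k Lc] by linarith
qed (use assms in simp)

text \<open>Pulling back \<open>k\<close> times leaves the letter \<open>z\<close> against \<open>\<sigma>\<^sup>j(z')\<close>, and the latter has more than one
  letter for \<open>j > 0\<close>. The letter \<open>c\<close> has to be excluded since \<open>\<sigma>(c) = a\<close>.\<close>

lemma counts_sig_inj:
  assumes "k \<le> k'" and "z \<noteq> Lc" and "z' \<noteq> Lc"
    and "count_list (sig k z) = count_list (sig k' z')"
  shows "k = k' \<and> z = z'"
proof -
  obtain j where j: "k' = k + j" using assms(1) le_Suc_ex by blast
  then have "count_list ((sigma_word ^^ k) [z]) = count_list ((sigma_word ^^ k) (sig j z'))"
    using assms(4) by (simp add: funpow_add)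
  then have c: "count_list [z] = count_list (sig j z')"
    by (rule count_sigma_word_pow_inj)
  then have len: "length [z] = length (sig j z')" by (simp only: length_eq_counts)
  have "j = 0"
  proof (cases j)
    case (Suc i)
    then show ?thesis using length_sig_ge_2[OF assms(3), of i] len by simp
  qed simp
  moreover from this have "z = z'"
    using fun_cong[OF c, of z] by (auto split: if_splits)
  ultimately show ?thesis using j by simp
qed

lemma rotate_sig_inj:
  assumes "rotate s (sig k z) = rotate s' (sig k' z')" "z \<noteq> Lc" "z' \<noteq> Lc"
    and "s < length (sig k z)" "s' < length (sig k' z')"
  shows "z = z' \<and> k = k' \<and> s = s'"
proof -
  have "count_list (sig k z) = count_list (sig k' z')"
    using assms(1) count_list_rotate by metis
  then have "k = k' \<and> z = z'"
    using counts_sig_inj[of k k' z z'] counts_sig_inj[of k' k z' z] assms(2,3)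
    by (metis nat_le_linear)
  then show ?thesis
    using rotate_sig_neq assms by (metis nat_neq_iff)
qed

section \<open>Lengths of the iterated images\<close>

abbreviation len :: "nat \<Rightarrow> letter \<Rightarrow> nat" where
  "len k z \<equiv> length (sig k z)"

lemma len_0: "len 0 z = 1"
  by simp

lemma len_Suc:
  "len (Suc k) La = len k La + len k Lb"
  "len (Suc k) Lb = len k La + len k Lc"
  "len (Suc k) Lc = len k La"
  by (simp_all only: sig_Suc length_append)

lemma len_mono: "k \<le> k' \<Longrightarrow> len k z \<le> len k' z"
  by (rule lift_Suc_mono_le) (simp_all add: length_sigma_word)

text \<open>Applying \<open>w \<mapsto> \<sigma>(w)a\<close> to \<open>v\<^sub>k\<^sub>+\<^sub>1 = \<sigma>\<^sup>k(a) v\<^sub>k\<close> gives the same equation one level higher. It turns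
  lengths of \<open>v\<^sub>k\<close> into sums of Tribonacci numbers.\<close>

lemma bispecial_Suc_eq: "bispecial (Suc k) = sig k La @ bispecial k"
proof (induction k)
  case (Suc k)
  have "sigma_word (bispecial (Suc k)) = sigma_word (sig k La) @ sigma_word (bispecial k)"
    by (simp only: Suc sigma_word_append)
  then show ?case by simp
qed (simp add: sigma_word_def)

lemma length_bispecial_Suc: "length (bispecial (Suc k)) = len k La + length (bispecial k)"
  by (simp only: bispecial_Suc_eq length_append)

text \<open>Together with \<open>len_triangle\<close> and \<open>len_le\<close>, this makes every comparison of \<open>\<bar>v\<^sub>k\<bar>\<close> with the
  lengths \<open>\<bar>\<sigma>\<^sup>k(z)\<bar>\<close> a matter of linear arithmetic.\<close>

lemma length_bispecial: "2 * length (bispecial k) + 3 = len k La + len k Lb + len k Lc"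
proof (induction k)
  case (Suc k)
  then show ?case unfolding length_bispecial_Suc len_Suc by simp
qed (simp add: len_0)

lemma len_triangle:
  "len k La < len k Lb + len k Lc \<and> len k Lb < len k La + len k Lc \<and> len k Lc < len k La + len k Lb"
proof (induction k)
  case (Suc k)
  then show ?case unfolding len_Suc by linarith
qed (simp add: len_0)

lemma len_le: "len k Lc \<le> len k Lb \<and> len k Lb \<le> len k La"
proof (induction k)
  case (Suc k)
  then show ?case unfolding len_Suc by linarith
qed (simp add: len_0)

lemma len_Lb_less: "len (k + 2) Lb < len (k + 2) La"
  using sig_pos[of k Lc] by (simp add: len_Suc del: funpow.simps)

lemma len_trib: 
  "trib (int k) = len k La \<and> trib (int k - 1) = len k Lc
    \<and> trib (int k - 1) + trib (int k - 2) = len k Lb"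
proof (induction k)
  case 0
  then show ?case by (simp add: trib_initial)
next
  case (Suc k)
  have "trib (int (Suc k)) = trib (int k) + trib (int k - 1) + trib (int k - 2)"
    using trib_rec[of "int (Suc k)"] by simp
  then show ?case using Suc unfolding len_Suc by simp
qed

section \<open>The squares in a prefix\<close>

text \<open>For \<open>z \<in> {a, b}\<close> and \<open>k \<le> n + 1\<close>, the number of rotations of \<open>\<sigma>\<^sup>k(z)\<close> whose squares occur in
  the prefix of length \<open>t\<^sub>n\<^sub>+\<^sub>3\<close>. For
  \<open>z = a\<close> and \<open>k < n\<close> these are all rotations, thanks to the first occurrence of \<open>c\<close>; otherwise
  only the offsets that fit into \<open>v\<^sub>k\<close> count.\<close>

definition offsets :: "nat \<Rightarrow> letter \<Rightarrow> nat \<Rightarrow> nat" where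
  "offsets n z k = (if z = La \<and> k < n then len k La else length (bispecial k) + 1 - len k z)"

lemma offsets_le: "z \<noteq> Lc \<Longrightarrow> offsets n z k \<le> len k z"
  using length_bispecial[of k] len_triangle[of k] len_le[of k]
  by (cases z) (auto simp: offsets_def)

lemma first_letters: "T 0 = La" "T 1 = Lb" "T 2 = La" "T 3 = Lc"
proof -
  show 0: "T 0 = La" using T_pos[of 0] by simp
  then have p: "pos 1 = 2" using pos_Suc[of 0] by simp
  show 1: "T 1 = Lb" using T_pos_plus_1[of 0] 0 by simp
  show "T 2 = La" "T 3 = Lc"
    using p 1 T_pos[of 1] T_pos_plus_1[of 1] by simp_all
qed

lemma pos_pow_first:
  "(pos ^^ k) 1 = len k La" "(pos ^^ k) 3 = 2 * len k La + len k Lb"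
proof -
  show 1: "(pos ^^ k) 1 = len k La" 
    using pos_pow_Suc[of k 0] first_letters by simp
  have "(pos ^^ k) 2 = len k La + len k Lb"
    using pos_pow_Suc[of k 1] 1 first_letters by (simp add: numeral_2_eq_2)
  then show "(pos ^^ k) 3 = 2 * len k La + len k Lb"
    using pos_pow_Suc[of k 2] first_letters by (simp add: numeral_3_eq_3 numeral_2_eq_2)
qed

text \<open>The leftmost occurrence of a root arises from the first \<open>a\<close>, \<open>b\<close> or \<open>c\<close>, at position 0, 1 or 3,
  so these positions decide what fits. The squares from \<open>a\<close> and \<open>b\<close> at level \<open>n + 2\<close> and those from
  \<open>c\<close> at level \<open>n + 1\<close> end beyond the prefix. At lower levels every offset fits from \<open>a\<close> and \<open>b\<close>,
  and from \<open>c\<close> enough offsets fit to give all rotations.\<close>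

lemma squares_of_prefix:
  "{w. w \<noteq> [] \<and> sublist (w @ w) (stake (len (n + 3) La) tribonacci_word)} =
    (\<lambda>((z, k), s). rotate s (sig k z)) `
      Sigma ({La, Lb} \<times> {..n + 1}) (\<lambda>(z, k). {..<offsets n z k})" (is "?S = ?f ` ?I")
proof (intro equalityI subsetI)
  fix w assume "w \<in> ?S"
  then obtain k R s where *: "s + len k (T R) \<le> length (bispecial k)"
      "(pos ^^ k) R + s + 2 * len k (T R) \<le> len (n + 3) La"
      "w = rotate s (sig k (T R))" unfolding mem_Collect_eq square_root_characterization by blast
  have pos_mono: "r \<le> R \<Longrightarrow> (pos ^^ k) r \<le> (pos ^^ k) R" for r
    using strict_mono_less_eq[OF strict_mono_pos_pow] by blast
  have len3: "len (n + 3) La = len (n + 2) La + len (n + 2) Lb"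
    using len_Suc(1)[of "n + 2"] by (simp add: numeral_3_eq_3 numeral_2_eq_2)
  have len2: "len (n + 2) La = len (n + 1) La + len (n + 1) Lb"
     "len (n + 2) Lb = len (n + 1) La + len n La"
    using len_Suc[of "n + 1"] len_Suc(3)[of n] by (simp_all add: numeral_2_eq_2)
  show "w \<in> ?f ` ?I"
  proof (cases "T R")
    case La
    have k: "k \<le> n + 1"
    proof (rule ccontr)
      assume "\<not> ?thesis"
      then have "len (n + 2) La \<le> len k La" by (intro len_mono) simp
      then show False using * La len3 len_Lb_less[of n] by simp
    qed
    have "s < offsets n La k"
      using * La length_bispecial[of k] len_le[of k] by (auto simp: offsets_def)
    then show ?thesis using k * La by (intro image_eqI[of _ _ "((La, k), s)"]) auto
  next
    case Lb
    have "R \<ge> 1" using Lb first_letters(1) by (cases R) auto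
    then have R: "len k La \<le> (pos ^^ k) R" using pos_mono[of 1] pos_pow_first by simp
    have k: "k \<le> n + 1"
    proof (rule ccontr)
      assume "\<not> ?thesis"
      then have "len (n + 2) La \<le> len k La" "len (n + 2) Lb \<le> len k Lb"
        by (intro len_mono; simp)+
      then show False using * Lb R len3 sig_pos[of k Lb] by simp
    qed
    have "s < offsets n Lb k"
      using * Lb by (auto simp: offsets_def)
    then show ?thesis using k * Lb by (intro image_eqI[of _ _ "((Lb, k), s)"]) auto
  next
    case Lc
    have "R \<noteq> 0" "R \<noteq> 1" "R \<noteq> 2" using Lc first_letters by (intro notI; simp)+
    then have "3 \<le> R" by simp
    then have R: "2 * len k La + len k Lb \<le> (pos ^^ k) R" using pos_mono[of 3] pos_pow_first by simp
    have "k \<noteq> 0" using * sig_pos[of k Lc] Lc by (cases k) auto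
    then obtain k' where k': "k = Suc k'" using not0_implies_Suc by blast
    have e: "sig k (T R) = sig k' La" using k' Lc sig_Suc(3) by simp
    have k: "k' < n"
    proof (rule ccontr)
      assume "\<not> ?thesis"
      then have "len (n + 1) La \<le> len k La" "len (n + 1) Lb \<le> len k Lb" "len n La \<le> len k' La"
        using k' by (intro len_mono; simp)+
      then show False using * e R len3 len2 sig_pos[of n La] by simp
    qed
    have "s mod len k' La < offsets n La k'"
      using k sig_pos[of k' La] by (simp add: offsets_def)
    moreover have "w = rotate (s mod len k' La) (sig k' La)"
      using * e rotate_conv_mod by metis
    ultimately show ?thesis using k by (intro image_eqI[of _ _ "((La, k'), s mod len k' La)"]) auto
  qed
next
  fix w assume "w \<in> ?f ` ?I"
  then obtain z k s where *: "z = La \<or> z = Lb" "k \<le> n + 1" "s < offsets n z k"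
    "w = rotate s (sig k z)" by auto
  have "\<exists>k R s. s + len k (T R) \<le> length (bispecial k)
      \<and> (pos ^^ k) R + s + 2 * len k (T R) \<le> len (n + 3) La \<and> w = rotate s (sig k (T R))"
  proof (cases "z = La \<and> k < n")
    case True
    \<comment> \<open>All rotations of \<open>\<sigma>\<^sup>k(a) = \<sigma>\<^sup>k\<^sup>+\<^sup>1(c)\<close> come from the first \<open>c\<close>, at position 3.\<close>
    have "len (k + 4) La \<le> len (n + 3) La" using True by (intro len_mono) simp
    moreover have "len (k + 4) La = len (k + 3) La + len (k + 3) Lb"
      "len (k + 3) La = len (k + 2) La + len (k + 2) Lb"
      "len (k + 3) Lb = len (k + 2) La + len (k + 2) Lc"
      "len (k + 2) La = len (Suc k) La + len (Suc k) Lb" 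
      "len (k + 2) Lb = len (Suc k) La + len (Suc k) Lc"
      "len (k + 2) Lc = len (Suc k) La"
      using len_Suc[of "k + 3"] len_Suc[of "k + 2"] len_Suc[of "k + 1"]
      by (simp_all add: eval_nat_numeral)
    moreover have "s < len k La" using * True by (simp add: offsets_def)
    ultimately have "(pos ^^ Suc k) 3 + s + 2 * len (Suc k) (T 3) \<le> len (n + 3) La"
      using len_Suc[of k] unfolding first_letters pos_pow_first by linarith
    moreover have "s + len (Suc k) (T 3) \<le> length (bispecial (Suc k))"
      using \<open>s < len k La\<close> length_bispecial[of k] len_triangle[of k]
      unfolding first_letters length_bispecial_Suc len_Suc by linarith
    moreover have "w = rotate s (sig (Suc k) (T 3))"
      using * True unfolding first_letters sig_Suc by simp
    ultimately show ?thesis by blast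
  next
    case False
    then have s: "s + len k z \<le> length (bispecial k)"
      using * by (auto simp: offsets_def)
    have "len (Suc (Suc k)) La \<le> len (n + 3) La" using * by (intro len_mono) simp
    then have le: "2 * len k La + len k Lb + len k Lc \<le> len (n + 3) La"
        "len k La + len k Lb + len k La + len k Lc \<le> len (n + 3) La"
      unfolding len_Suc by linarith+
    define R :: nat where "R = (if z = La then 0 else 1)"
    have R: "T R = z" using *(1) first_letters by (auto simp: R_def)
    have "(pos ^^ k) R + s + 2 * len k z \<le> len (n + 3) La"
      using *(1) s le length_bispecial[of k] len_triangle[of k] pos_pow_first(1)[of k]
      by (auto simp: R_def)
    then show ?thesis using s *(4) R by blast
  qed
  then show "w \<in> ?S" unfolding mem_Collect_eq square_root_characterization .
qed

lemma num_squares_sum: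
  "num_squares (len (n + 3) La) = (\<Sum>k\<le>n + 1. offsets n La k) + (\<Sum>k\<le>n + 1. offsets n Lb k)"
proof -
  let ?f = "\<lambda>((z, k), s). rotate s (sig k z)"
  let ?I = "Sigma ({La, Lb} \<times> {..n + 1}) (\<lambda>(z, k). {..<offsets n z k})"
  have "inj_on ?f ?I"
  proof (rule inj_onI)
    fix x y assume x: "x \<in> ?I" and y: "y \<in> ?I" and e: "?f x = ?f y"
    obtain z k s where xe: "x = ((z, k), s)" by (metis prod.exhaust)
    obtain z' k' s' where ye: "y = ((z', k'), s')" by (metis prod.exhaust)
    have z: "z \<noteq> Lc" "z' \<noteq> Lc" using x y xe ye by auto
    then have "s < len k z" "s' < len k' z'"
      using x y xe ye offsets_le[of z n k] offsets_le[of z' n k'] by auto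
    then show "x = y" using rotate_sig_inj[of s k z s' k' z'] e z xe ye by simp
  qed
  then have "num_squares (len (n + 3) La) = card ?I"
    unfolding num_squares_def squares_of_prefix by (rule card_image)
  also have "\<dots> = (\<Sum>(z, k)\<in>{La, Lb} \<times> {..n + 1}. offsets n z k)"
    by (subst card_SigmaI) (auto intro!: sum.cong)
  also have "\<dots> = (\<Sum>z\<in>{La, Lb}. \<Sum>k\<le>n + 1. offsets n z k)"
    by (simp only: sum.cartesian_product)
  finally show ?thesis by simp
qed

lemma sum_len_La: "(\<Sum>k<n. len k La) = length (bispecial n)"
  by (induction n) (simp_all only: length_bispecial_Suc sum.lessThan_Suc, simp_all)

text \<open>The full sets of rotations, for \<open>k < n\<close>, add up to \<open>\<bar>v\<^sub>n\<bar>\<close>; two more levels remain.\<close>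

lemma sum_offsets_La:
  "2 * int (\<Sum>k\<le>n + 1. offsets n La k)
    = int (len n La) + int (len n Lb) + 3 * int (len n Lc) - 5"
proof -
  have "(\<Sum>k\<le>n + 1. offsets n La k) = (\<Sum>k<n. offsets n La k) + offsets n La n + offsets n La (Suc n)"
    by (simp add: lessThan_Suc_atMost[symmetric])
  also have "(\<Sum>k<n. offsets n La k) = length (bispecial n)"
    unfolding sum_len_La[symmetric] by (rule sum.cong) (auto simp: offsets_def)
  finally have "(\<Sum>k\<le>n + 1. offsets n La k) = length (bispecial n) + (length (bispecial n) + 1 - len n La)
      + (length (bispecial (Suc n)) + 1 - len (Suc n) La)"
    by (simp only: offsets_def) simp
  then show ?thesis
    using length_bispecial[of n] len_triangle[of n] 
    unfolding length_bispecial_Suc len_Suc by linarith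
qed

text \<open>The parameter \<open>m\<close> is arbitrary since \<open>offsets\<close> depends on it for the letter \<open>a\<close> only; so the sum
  can be evaluated by induction on its upper bound.\<close>

lemma sum_offsets_Lb:
  "2 * int (\<Sum>k\<le>n. offsets m Lb k) = int (len n La) + int (len n Lc) - int n - 2"
proof (induction n)
  case 0
  then show ?case by (simp add: offsets_def)
next
  case (Suc n)
  have "offsets m Lb (Suc n) = length (bispecial (Suc n)) + 1 - len (Suc n) Lb"
    by (simp add: offsets_def)
  then have "2 * int (offsets m Lb (Suc n)) = int (len (Suc n) La) + int (len (Suc n) Lc) - int (len (Suc n) Lb) - 1"
    using length_bispecial[of "Suc n"] len_triangle[of "Suc n"] by linarith
  then show ?case using Suc unfolding sum.atMost_Suc len_Suc by simp
qed

theorem theorem4p3: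
  fixes m :: int
  assumes "m \<ge> 3"
  shows "real (num_squares (trib m)) =
    1 / 2 * (2 * real (trib (m - 2)) + real (trib (m - 3)) + 3 * real (trib (m - 4))
             - real_of_int m - 5)"
proof -
  define n where "n = nat (m - 3)"
  have m: "m = int (n + 3)" using assms by (simp add: n_def)
  have t: "trib m = len (n + 3) La" "trib (m - 2) = len (Suc n) La"
    "trib (m - 3) = len n La" "trib (m - 4) = len n Lc"
    using len_trib[of "n + 3"] len_trib[of "Suc n"] len_trib[of n] unfolding m
    by (simp_all del: funpow.simps add: algebra_simps)
  have "2 * int (num_squares (trib m))
      = 2 * int (trib (m - 2)) + int (trib (m - 3)) + 3 * int (trib (m - 4)) - m - 5"
  proof -
    have "int (len (n + 1) La) = int (len n La) + int (len n Lb)"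
      "int (len (n + 1) Lc) = int (len n La)"
      using len_Suc[of n] by simp_all
    moreover have "2 * (x + y) = 2 * a' + a + 3 * c - (i + 3) - 5"
      if "a' = a + b" "c' = a" "2 * x = a + b + 3 * c - 5" "2 * y = a' + c' - (i + 1) - 2"
      for a b c a' c' x y i :: int
      using that by (simp add: algebra_simps)
    ultimately show ?thesis
      using sum_offsets_La[of n] sum_offsets_Lb[of n "n + 1"]
      unfolding t num_squares_sum Suc_eq_plus1 unfolding m of_nat_add of_nat_numeral of_nat_1
      by blast
  qed
  then have "2 * real (num_squares (trib m))
      = 2 * real (trib (m - 2)) + real (trib (m - 3)) + 3 * real (trib (m - 4)) - real_of_int m - 5"
    by linarith
  then show ?thesis by simp
qed

end
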